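(* Let $\mu$ be a probability measure on $\mathbb{R}^d$ that is absolutely continuous with respect to Lebesgue measure, let $t>0$, and let $\eta$ be a Poisson point process on $\mathbb{R}^d$ with intensity measure $t\mu$. Let $\Pi_t=[\eta]$ be the convex hull of the points of $\eta$, let $N(\Pi_t)$ be the number of vertices of $\Pi_t$, and let $\Delta(\Pi_t)=\mu(\mathbb{R}^d\setminus\Pi_t)$. Then for every $k\in\mathbb{N}$, $$\mathbb{E}\, N(\Pi_t)_{(k)}=t^k\,\mathbb{E}\,\Delta(\Pi_t)^k - t^k\sum_{r=1}^{k-1}(-1)^{r+1}\binom{k}{r}\,\mathbb{E}\int_{\mathbb{R}^d\setminus\Pi_t}\!\!\cdots\int_{\mathbb{R}^d\setminus\Pi_t}\mu\big([\eta,x_1,\dots,x_{k-r}]\setminus[\eta]\big)^r\,\mu(\mathrm{d}x_1)\cdots\mu(\mathrm{d}x_{k-r}),$$ where $n_{(k)}=n(n-1)\cdots(n-k+1)$.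
   Context: For a point set $\xi$, $[\xi]$ denotes its convex hull, and $[\eta,x_1,\dots,x_m]$ denotes the convex hull of the points of $\eta$ together with the points $x_1,\dots,x_m$. A Poisson point process $\eta$ with intensity measure $t\mu$ is a random finite simple counting measure such that $\eta(A)$ is Poisson distributed with parameter $t\mu(A)$ for every Borel set $A$ and counts of pairwise disjoint Borel sets are independent. *)

theory Defs
  imports "HOL-Probability.Probability"
begin

text \<open>A random variable with values in nat is Poisson distributed with parameter lam \<ge> 0
  (the case lam = 0 means the point mass at 0).\<close>
definition poisson_distributed :: "'w measure \<Rightarrow> ('w \<Rightarrow> nat) \<Rightarrow> real \<Rightarrow> bool" where
  "poisson_distributed M X lam \<longleftrightarrow>
     X \<in> measurable M (count_space UNIV) \<and>
     (\<forall>n. measure M {w \<in> space M. X w = n} = lam ^ n / fact n * exp (- lam))"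

text \<open>A Poisson point process on the space of mu with intensity measure t * mu, given as a random
  finite simple counting measure, represented by its (finite) support set eta w.
  eta(A) is the number of points of eta w lying in A.\<close>
definition poisson_point_process ::
  "'w measure \<Rightarrow> 'a measure \<Rightarrow> real \<Rightarrow> ('w \<Rightarrow> 'a set) \<Rightarrow> bool" where
  "poisson_point_process M mu t eta \<longleftrightarrow>
     (\<forall>w\<in>space M. finite (eta w) \<and> eta w \<subseteq> space mu) \<and>
     (\<forall>A\<in>sets mu. poisson_distributed M (\<lambda>w. card (eta w \<inter> A)) (t * measure mu A)) \<and>
     (\<forall>(I :: nat set) A. A ` I \<subseteq> sets mu \<longrightarrow> disjoint_family_on A I \<longrightarrow>
        prob_space.indep_vars M (\<lambda>_. count_space UNIV) (\<lambda>i w. card (eta w \<inter> A i)) I)"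

definition num_vertices :: "'a::euclidean_space set \<Rightarrow> nat" where
  "num_vertices P = card {x. x extreme_point_of P}"

definition falling_fact :: "nat \<Rightarrow> nat \<Rightarrow> real" where
  "falling_fact n k = (\<Prod>i<k. real n - real i)"

end

theory Submission
  imports Defs
begin

text \<open>
  The law of a finite random set is determined by its void probabilities, and those of the Poisson
  process are the ones of a Poisson number of independent points with law \<open>mu\<close>. Hence, by
  exchangeability, the \<open>k\<close>-th factorial moment of the number of vertices is \<open>t ^ k\<close> times the
  probability that \<open>k\<close> additional independent points \<open>x\<close> are all vertices of the hull of
  \<open>\<eta>\<close> and \<open>x\<close>. For distinct points outside the hull of \<open>\<eta>\<close>, all \<open>x i\<close> with
  \<open>i \<in> S\<close> fail to be vertices iff they lie in the hull of \<open>\<eta>\<close> and the remaining points;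
  inclusion-exclusion over \<open>S\<close> and integration over the \<open>x i\<close> with \<open>i \<in> S\<close> give the formula,
  the term \<open>S = {..<k}\<close> being zero. Absolute continuity makes the points almost surely distinct.
\<close>

section \<open>Finite configurations\<close>

definition void :: "'a set \<Rightarrow> 'a set set" where
  "void A = {\<xi>. finite \<xi> \<and> \<xi> \<inter> A = {}}"

text \<open>Void events alone generate the sigma-algebra: measurability of a random set then only
  has to be tested on them, and they form an intersection-stable class, so they also determine laws.
  Cardinality, vertices and hull membership are shown below to be measurable for it.\<close>

definition conf :: "'a::topological_space set measure" where
  "conf = sigma (Collect finite) (void ` sets borel)"

lemma void_Int: "void A \<inter> void B = void (A \<union> B)"
  by (auto simp: void_def)

lemma space_conf [simp]: "space conf = Collect finite"
  by (simp add: conf_def space_measure_of_conv)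

lemma sets_conf: "sets conf = sigma_sets (Collect finite) (void ` sets borel)"
  unfolding conf_def by (rule sets_measure_of) (auto simp: void_def)

lemma sets_void [measurable]: "A \<in> sets borel \<Longrightarrow> void A \<in> sets conf"
  by (auto simp: sets_conf)

lemma measurable_confI:
  assumes "\<And>x. x \<in> space N \<Longrightarrow> finite (f x)"
    and "\<And>A. A \<in> sets borel \<Longrightarrow> {x \<in> space N. f x \<inter> A = {}} \<in> sets N"
  shows "f \<in> N \<rightarrow>\<^sub>M conf"
  unfolding conf_def
proof (rule measurable_measure_of)
  fix B assume "B \<in> void ` sets (borel :: 'b measure)"
  then obtain A where "A \<in> sets borel" "B = void A" by auto
  moreover from this have "f -` B \<inter> space N = {x \<in> space N. f x \<inter> A = {}}"
    using assms(1) by (auto simp: void_def)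
  ultimately show "f -` B \<inter> space N \<in> sets N"
    using assms(2) by simp
qed (use assms(1) in \<open>auto simp: void_def\<close>)

lemma void_measurable_pred:
  assumes "f \<in> N \<rightarrow>\<^sub>M conf" "A \<in> sets borel"
  shows "{x \<in> space N. f x \<inter> A = {}} \<in> sets N"
proof -
  have "f -` void A \<inter> space N \<in> sets N"
    using assms by (auto intro: measurable_sets)
  moreover have "f -` void A \<inter> space N = {x \<in> space N. f x \<inter> A = {}}"
    using measurable_space[OF assms(1)] by (auto simp: void_def)
  ultimately show ?thesis by simp
qed

lemma void_pred [measurable (raw)]:
  assumes "f \<in> N \<rightarrow>\<^sub>M conf" "A \<in> sets borel"
  shows "Measurable.pred N (\<lambda>x. f x \<inter> A = {})"
  using void_measurable_pred[OF assms] by (simp add: pred_def)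

text \<open>Void events are closed under intersection, since \<open>void A\<close> and
  \<open>void B\<close> meet in \<open>void (A \<union> B)\<close>, and \<open>void {}\<close> is
  the whole space. Uniqueness of measures on a generating intersection-stable class gives the
  claim.\<close>

lemma conf_measure_eqI:
  assumes "prob_space N1" "prob_space N2" "sets N1 = sets conf" "sets N2 = sets conf"
    and "\<And>A. A \<in> sets borel \<Longrightarrow> emeasure N1 (void A) = emeasure N2 (void A)"
  shows "N1 = N2"
proof (rule measure_eqI_generator_eq[where E = "void ` sets borel" and \<Omega> = "Collect finite"
      and A = "\<lambda>_. Collect finite"])
  show "Int_stable (void ` sets (borel :: 'a measure))"
    by (auto simp: Int_stable_def void_Int intro!: imageI)
  show "range (\<lambda>_. Collect finite) \<subseteq> void ` sets (borel :: 'a measure)"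
    by (auto simp: void_def intro!: image_eqI[where x = "{}"])
  show "emeasure N1 (Collect finite) \<noteq> \<infinity>"
    using assms(1) by (simp add: finite_measure.emeasure_finite prob_space.finite_measure)
  show "void ` sets borel \<subseteq> Pow (Collect finite :: 'a set set)" by (auto simp: void_def)
  show "sets N1 = sigma_sets (Collect finite) (void ` sets borel)"
    "sets N2 = sigma_sets (Collect finite) (void ` sets borel)"
    using assms(3,4) by (simp_all only: sets_conf)
qed (use assms(5) in auto)

lemma measurable_Un_conf [measurable (raw)]:
  assumes [measurable]: "f \<in> N \<rightarrow>\<^sub>M conf" "g \<in> N \<rightarrow>\<^sub>M conf"
  shows "(\<lambda>x. f x \<union> g x) \<in> N \<rightarrow>\<^sub>M conf"
proof (rule measurable_confI)
  fix A :: "'b set" assume [measurable]: "A \<in> sets borel"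
  have "{x \<in> space N. (f x \<union> g x) \<inter> A = {}} = {x \<in> space N. f x \<inter> A = {} \<and> g x \<inter> A = {}}"
    by auto
  also have "\<dots> \<in> sets N" by measurable
  finally show "{x \<in> space N. (f x \<union> g x) \<inter> A = {}} \<in> sets N" .
qed (use measurable_space[OF assms(1)] measurable_space[OF assms(2)] in auto)

lemma measurable_image_conf:
  assumes "finite J" "sets mu = sets borel"
  shows "(\<lambda>x. x ` J) \<in> PiM J (\<lambda>_. mu) \<rightarrow>\<^sub>M conf"
proof (rule measurable_confI)
  fix A :: "'b set" assume "A \<in> sets borel"
  then have [measurable]: "A \<in> sets mu" using assms by simp
  have "{x \<in> space (PiM J (\<lambda>_. mu)). x ` J \<inter> A = {}} = {x \<in> space (PiM J (\<lambda>_. mu)). \<forall>i\<in>J. x i \<notin> A}"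
    by auto
  also have "\<dots> \<in> sets (PiM J (\<lambda>_. mu))"
    using assms(1) by measurable
  finally show "{x \<in> space (PiM J (\<lambda>_. mu)). x ` J \<inter> A = {}} \<in> sets (PiM J (\<lambda>_. mu))" .
qed (use assms in auto)

section \<open>Measurability of hulls and vertices\<close>

lemma pred_Ball_countable:
  assumes "countable I" "\<And>i. i \<in> I \<Longrightarrow> Measurable.pred N (\<lambda>x. P x i)"
  shows "Measurable.pred N (\<lambda>x. \<forall>i\<in>I. P x i)"
  using assms by (auto simp: pred_def intro!: sets.sets_Collect_countable_Ball)

lemma pred_Bex_countable:
  assumes "countable I" "\<And>i. i \<in> I \<Longrightarrow> Measurable.pred N (\<lambda>x. P x i)"
  shows "Measurable.pred N (\<lambda>x. \<exists>i\<in>I. P x i)"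
  using assms by (auto simp: pred_def intro!: sets.sets_Collect_countable_Bex)

text \<open>A fixed countable dense set of normal directions keeps every quantification over half
  spaces countable.\<close>

definition dirs :: "'a::euclidean_space set" where
  "dirs = (SOME D. countable D \<and> (\<forall>X. open X \<longrightarrow> X \<noteq> {} \<longrightarrow> (\<exists>d\<in>D. d \<in> X)))"

lemma dirs_dense_aux:
  "countable (dirs :: 'a::euclidean_space set) \<and>
    (\<forall>X :: 'a set. open X \<longrightarrow> X \<noteq> {} \<longrightarrow> (\<exists>d\<in>dirs. d \<in> X))"
  unfolding dirs_def by (rule someI_ex) (rule countable_dense_exists)

lemmas countable_dirs [simp] = conjunct1[OF dirs_dense_aux]

lemmas dirs_dense = conjunct2[OF dirs_dense_aux, rule_format]

text \<open>Strict separation of a point from the hull of finitely many points survives a small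
  perturbation of the direction, so countably many half spaces detect membership in the hull.\<close>

lemma notin_hull_iff:
  fixes \<xi> :: "'a::euclidean_space set"
  assumes "finite \<xi>"
  shows "y \<notin> convex hull \<xi> \<longleftrightarrow>
    (\<exists>u\<in>dirs. \<exists>q\<in>\<rat>. u \<bullet> y > q \<and> \<xi> \<inter> {z. q \<le> u \<bullet> z} = {})" (is "?L \<longleftrightarrow> ?R")
proof
  assume ?L
  have "compact (convex hull \<xi>)" "convex (convex hull \<xi>)"
    using assms by (auto simp: finite_imp_compact_convex_hull)
  then obtain a b where ab: "a \<bullet> y < b" "\<And>z. z \<in> convex hull \<xi> \<Longrightarrow> a \<bullet> z > b"
    using separating_hyperplane_closed_point[of "convex hull \<xi>" y] \<open>?L\<close> compact_imp_closed by blast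
  \<comment> \<open>\<open>U\<close> collects the directions that separate strictly at level
    \<open>- b\<close>; the sign is flipped because the separation theorem puts \<open>y\<close> on
    the lower side. As \<open>\<xi>\<close> is finite, \<open>U\<close> is open, so it contains a
    direction from \<open>dirs\<close>, and strictness at \<open>y\<close> leaves room for a
    rational level.\<close>
  define U where "U = {u. u \<bullet> y > - b} \<inter> (\<Inter>z\<in>\<xi>. {u. u \<bullet> z < - b})"
  have "open U" unfolding U_def using assms
    by (intro open_Int open_INT ballI open_Collect_less continuous_intros) auto
  moreover have "- a \<in> U" using ab hull_inc[of _ \<xi> convex] by (fastforce simp: U_def)
  ultimately obtain u where u: "u \<in> dirs" "u \<in> U"
    using dirs_dense[of U] by auto
  then have "- b < u \<bullet> y" by (auto simp: U_def)
  then obtain q where q: "q \<in> \<rat>" "- b < q" "q < u \<bullet> y"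
    using Rats_dense_in_real by blast
  have "\<xi> \<inter> {z. q \<le> u \<bullet> z} = {}"
    using u q by (force simp: U_def)
  with u q show ?R by auto
next
  assume ?R
  then obtain u q where uq: "u \<bullet> y > q" "\<xi> \<inter> {z. q \<le> u \<bullet> z} = {}" by auto
  have "convex hull \<xi> \<subseteq> {z. u \<bullet> z < q}"
    by (rule hull_minimal) (use uq in \<open>auto simp: convex_halfspace_lt\<close>)
  with uq show ?L by auto
qed

text \<open>For fixed \<open>u\<close> and \<open>q\<close>, separation is a Borel condition on
  \<open>g x\<close> together with a void event for \<open>f x\<close>; only countably many pairs
  occur.\<close>

lemma pred_mem_hull [measurable (raw)]:
  fixes g :: "'b \<Rightarrow> 'a::euclidean_space"
  assumes [measurable]: "f \<in> N \<rightarrow>\<^sub>M conf" "g \<in> N \<rightarrow>\<^sub>M borel"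
  shows "Measurable.pred N (\<lambda>x. g x \<in> convex hull (f x))"
proof -
  have "Measurable.pred N (\<lambda>x. \<not> (\<exists>u\<in>dirs. \<exists>q\<in>\<rat>. u \<bullet> g x > q \<and> f x \<inter> {z. q \<le> u \<bullet> z} = {}))"
    by (intro pred_intros_logic(2) pred_Bex_countable countable_dirs countable_rat) measurable
  then show ?thesis
    by (rule measurable_cong[THEN iffD1, rotated])
       (use measurable_space[OF assms(1)] in \<open>simp only: notin_hull_iff[symmetric] space_conf mem_Collect_eq not_not\<close>)
qed

section \<open>Vertices of the hull of a configuration\<close>

definition verts :: "'a::euclidean_space set \<Rightarrow> 'a set" where
  "verts \<xi> = {x. x extreme_point_of (convex hull \<xi>)}"

lemma verts_subset: "verts \<xi> \<subseteq> \<xi>"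
  by (auto simp: verts_def intro: extreme_point_of_convex_hull)

lemma hull_verts: "finite \<xi> \<Longrightarrow> convex hull (verts \<xi>) = convex hull \<xi>"
  unfolding verts_def
  by (rule Krein_Milman_Minkowski[symmetric]) (auto simp: finite_imp_compact_convex_hull)

text \<open>The vertices span the hull. If none of them lies in \<open>A\<close>, the points outside
  \<open>A\<close> already span it; conversely, if deleting \<open>A\<close> leaves the hull
  unchanged, the vertices are unchanged too and lie among the remaining points.\<close>

lemma verts_disjoint_iff:
  assumes "finite \<xi>"
  shows "verts \<xi> \<inter> A = {} \<longleftrightarrow> \<xi> \<subseteq> convex hull (\<xi> - A)"
proof
  assume "verts \<xi> \<inter> A = {}"
  then have "verts \<xi> \<subseteq> \<xi> - A" using verts_subset by auto
  then have "convex hull \<xi> \<subseteq> convex hull (\<xi> - A)"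
    using hull_verts[OF assms] hull_mono by metis
  then show "\<xi> \<subseteq> convex hull (\<xi> - A)" using hull_subset[of \<xi> convex] by (rule order_trans[rotated])
next
  assume "\<xi> \<subseteq> convex hull (\<xi> - A)"
  then have "convex hull \<xi> = convex hull (\<xi> - A)"
    by (intro equalityI hull_mono hull_minimal) auto
  then have "verts \<xi> = verts (\<xi> - A)" by (simp add: verts_def)
  then show "verts \<xi> \<inter> A = {}" using verts_subset[of "\<xi> - A"] by auto
qed

text \<open>Through \<open>verts_disjoint_iff\<close> and the half space criterion for hulls, a void
  event of \<open>verts \<xi>\<close> becomes a countable combination of void events of
  \<open>\<xi>\<close> itself.\<close>

lemma measurable_verts [measurable]: "verts \<in> conf \<rightarrow>\<^sub>M conf"
proof (rule measurable_confI)
  fix A :: "'a set" assume [measurable]: "A \<in> sets borel"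
  have *: "verts \<xi> \<inter> A = {} \<longleftrightarrow> (\<forall>u\<in>dirs. \<forall>q\<in>\<rat>.
      \<xi> \<inter> ({z. q \<le> u \<bullet> z} - A) = {} \<longrightarrow> \<xi> \<inter> {z. q < u \<bullet> z} = {})" if "finite \<xi>" for \<xi>
  proof -
    have "verts \<xi> \<inter> A = {} \<longleftrightarrow> (\<forall>y\<in>\<xi>. \<not> (y \<notin> convex hull (\<xi> - A)))"
      using verts_disjoint_iff[OF that] by auto
    also have "\<dots> \<longleftrightarrow> (\<forall>y\<in>\<xi>. \<not> (\<exists>u\<in>dirs. \<exists>q\<in>\<rat>. u \<bullet> y > q \<and> (\<xi> - A) \<inter> {z. q \<le> u \<bullet> z} = {}))"
      using notin_hull_iff[of "\<xi> - A"] that by auto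
    \<comment> \<open>Exchanging quantifiers removes \<open>y\<close>: some point of
      \<open>\<xi>\<close> satisfies \<open>u \<bullet> y > q\<close> exactly when
      \<open>\<xi>\<close> meets the open half space.\<close>
    also have "\<dots> \<longleftrightarrow> (\<forall>u\<in>dirs. \<forall>q\<in>\<rat>.
      \<xi> \<inter> ({z. q \<le> u \<bullet> z} - A) = {} \<longrightarrow> \<xi> \<inter> {z. q < u \<bullet> z} = {})"
    proof -
      have "(\<xi> - A) \<inter> {z. q \<le> u \<bullet> z} = \<xi> \<inter> ({z. q \<le> u \<bullet> z} - A)" for q u by auto
      then show ?thesis by (simp only: disjoint_iff) blast
    qed
    finally show ?thesis .
  qed
  have "Measurable.pred conf (\<lambda>\<xi>. \<forall>u\<in>dirs. \<forall>q\<in>\<rat>.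
      \<xi> \<inter> ({z. q \<le> u \<bullet> z} - A) = {} \<longrightarrow> \<xi> \<inter> {z. q < u \<bullet> z} = {})"
    by (intro pred_Ball_countable countable_dirs countable_rat) measurable
  then have "{\<xi> \<in> space conf. \<forall>u\<in>dirs. \<forall>q\<in>\<rat>.
      \<xi> \<inter> ({z. q \<le> u \<bullet> z} - A) = {} \<longrightarrow> \<xi> \<inter> {z. q < u \<bullet> z} = {}} \<in> sets conf"
    by (simp add: pred_def)
  also have "{\<xi> \<in> space conf. \<forall>u\<in>dirs. \<forall>q\<in>\<rat>.
      \<xi> \<inter> ({z. q \<le> u \<bullet> z} - A) = {} \<longrightarrow> \<xi> \<inter> {z. q < u \<bullet> z} = {}} = {\<xi> \<in> space conf. verts \<xi> \<inter> A = {}}"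
    by (rule Collect_cong, rule conj_cong, rule refl, rule *[symmetric]) simp
  finally show "{\<xi> \<in> space conf. verts \<xi> \<inter> A = {}} \<in> sets conf" .
qed (auto intro: finite_subset[OF verts_subset])

text \<open>A finite set is closed, so a point outside it has a neighbourhood in a countable basis
  that misses it. Inclusion is thus tested on countably many basic open sets.\<close>

lemma pred_subset_conf [measurable (raw)]:
  fixes f g :: "'b \<Rightarrow> 'a::euclidean_space set"
  assumes [measurable]: "f \<in> N \<rightarrow>\<^sub>M conf" "g \<in> N \<rightarrow>\<^sub>M conf"
  shows "Measurable.pred N (\<lambda>x. f x \<subseteq> g x)"
proof -
  obtain B :: "'a set set" where B: "countable B" "topological_basis B"
    using ex_countable_basis by auto
  have [measurable]: "b \<in> sets borel" if "b \<in> B" for b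
    using topological_basis_open[OF B(2) that] by simp
  have *: "\<alpha> \<subseteq> \<beta> \<longleftrightarrow> (\<forall>b\<in>B. \<beta> \<inter> b = {} \<longrightarrow> \<alpha> \<inter> b = {})" if "finite \<beta>" for \<alpha> \<beta>
  proof (intro iffI subsetI)
    fix x assume h: "\<forall>b\<in>B. \<beta> \<inter> b = {} \<longrightarrow> \<alpha> \<inter> b = {}" "x \<in> \<alpha>"
    show "x \<in> \<beta>"
    proof (rule ccontr)
      assume "x \<notin> \<beta>"
      moreover have "open (- \<beta>)" using that by (simp add: finite_imp_closed open_Compl)
      ultimately obtain b where "b \<in> B" "x \<in> b" "b \<subseteq> - \<beta>"
        using topological_basisE[OF B(2)] by (metis ComplI)
      with h show False by blast
    qed
  qed blast
  have "Measurable.pred N (\<lambda>x. \<forall>b\<in>B. g x \<inter> b = {} \<longrightarrow> f x \<inter> b = {})"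
    using B(1) by (intro pred_Ball_countable) measurable
  then show ?thesis
    by (rule measurable_cong[THEN iffD1, rotated])
       (use measurable_space[OF assms(2)] in \<open>simp only: *[symmetric] space_conf mem_Collect_eq\<close>)
qed

text \<open>A finite set has at least \<open>n\<close> points iff it hits each of \<open>n\<close>
  pairwise disjoint basic open sets, and there are only countably many such families.\<close>

lemma measurable_card_conf [measurable]:
  "(card :: 'a::euclidean_space set \<Rightarrow> nat) \<in> conf \<rightarrow>\<^sub>M count_space UNIV"
proof -
  obtain B :: "'a set set" where B: "countable B" "topological_basis B"
    using ex_countable_basis by auto
  have [measurable]: "b \<in> sets borel" if "b \<in> B" for b
    using topological_basis_open[OF B(2) that] by simp
  define FF where "FF n = {F. finite F \<and> F \<subseteq> B \<and> card F = n \<and> disjoint F}" for n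
  have cF: "countable (FF n)" for n
    using countable_Collect_finite_subset[OF B(1)] 
    by (rule countable_subset[rotated]) (auto simp: FF_def)
  have *: "n \<le> card \<xi> \<longleftrightarrow> (\<exists>F\<in>FF n. \<forall>b\<in>F. \<not> \<xi> \<inter> b = {})" if "finite \<xi>" for n and \<xi> :: "'a set"
  proof
    assume "n \<le> card \<xi>"
    then obtain X where X: "X \<subseteq> \<xi>" "card X = n" "finite X"
      using obtain_subset_with_card_n by metis
    have "\<exists>d>0. \<forall>y\<in>X. y \<noteq> x \<longrightarrow> d \<le> dist x y" for x
      using finite_set_avoid[OF X(3)] by metis
    then obtain d where d: "\<And>x. d x > 0" "\<And>x y. y \<in> X \<Longrightarrow> y \<noteq> x \<Longrightarrow> d x \<le> dist x y"
      by metis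
    \<comment> \<open>Half of the separation distance is used as radius: for distinct points of
      \<open>X\<close> the two radii then add up to at most their distance, so the balls are
      disjoint.\<close>
    have "\<exists>b\<in>B. x \<in> b \<and> b \<subseteq> ball x (d x / 2)" for x
      using topological_basisE[OF B(2) open_ball[of x "d x / 2"], of x] d(1)[of x] by auto
    then obtain b where b: "\<And>x. b x \<in> B" "\<And>x. x \<in> b x" "\<And>x. b x \<subseteq> ball x (d x / 2)"
      by metis
    have dis: "b x \<inter> b y = {}" if "x \<in> X" "y \<in> X" "x \<noteq> y" for x y
    proof -
      have "d x \<le> dist x y" "d y \<le> dist x y"
        using d(2)[of y x] d(2)[of x y] that by (auto simp: dist_commute)
      then have "ball x (d x / 2) \<inter> ball y (d y / 2) = {}"
        by (intro disjoint_ballI) auto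
      then show ?thesis using b(3)[of x] b(3)[of y] by blast
    qed
    have "inj_on b X"
      using dis b(2) by (metis IntI empty_iff inj_onI)
    then have "b ` X \<in> FF n"
      using X b(1) dis unfolding FF_def pairwise_def disjnt_def by (auto simp: card_image) blast+
    moreover have "\<forall>c\<in>b ` X. \<not> \<xi> \<inter> c = {}" using b(2) X(1) by blast
    ultimately show "\<exists>F\<in>FF n. \<forall>b\<in>F. \<not> \<xi> \<inter> b = {}" by blast
  next
    assume "\<exists>F\<in>FF n. \<forall>b\<in>F. \<not> \<xi> \<inter> b = {}"
    then obtain F where F: "finite F" "card F = n" "disjoint F" "\<And>b. b \<in> F \<Longrightarrow> \<exists>x. x \<in> \<xi> \<inter> b"
      unfolding FF_def by blast
    from F(4) obtain p where p: "\<And>b. b \<in> F \<Longrightarrow> p b \<in> \<xi> \<inter> b" by metis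
    \<comment> \<open>A point picked in two members of \<open>F\<close> would lie in their
      intersection, so disjointness makes the choice injective.\<close>
    have "inj_on p F"
    proof (rule inj_onI)
      fix a b assume "a \<in> F" "b \<in> F" "p a = p b"
      then have "p a \<in> a \<inter> b" using p by force
      then show "a = b"
        using F(3) \<open>a \<in> F\<close> \<open>b \<in> F\<close> by (auto simp: pairwise_def disjnt_def)
    qed
    then have "card F \<le> card \<xi>"
      using p that by (intro card_inj_on_le[of p]) auto
    then show "n \<le> card \<xi>" using F(2) by simp
  qed
  have "Measurable.pred conf (\<lambda>\<xi> :: 'a set. n \<le> card \<xi>)" for n
  proof -
    have "Measurable.pred conf (\<lambda>\<xi> :: 'a set. \<exists>F\<in>FF n. \<forall>b\<in>F. \<not> \<xi> \<inter> b = {})"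
      by (intro pred_Bex_countable pred_Ball_countable pred_intros_logic(2) cF void_pred)
         (auto simp: FF_def countable_finite)
    then show ?thesis
      by (rule measurable_cong[THEN iffD1, rotated]) (simp only: *[symmetric] space_conf mem_Collect_eq)
  qed
  then have "Measurable.pred conf (\<lambda>\<xi> :: 'a set. n \<le> card \<xi> \<and> \<not> Suc n \<le> card \<xi>)" for n
    by (intro pred_intros_logic)
  moreover have "n \<le> card \<xi> \<and> \<not> Suc n \<le> card \<xi> \<longleftrightarrow> card \<xi> = n" for n and \<xi> :: "'a set"
    by auto
  ultimately show ?thesis
    by (intro measurable_count_space_eq2_countable[THEN iffD2]) (auto simp: pred_def vimage_def Int_def conj_commute)
qed

section \<open>Independent samples\<close>

locale borel_prob = prob_space mu for mu :: "'a::euclidean_space measure" +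
  assumes sets_mu [measurable_cong]: "sets mu = sets borel"
begin

lemma space_mu [simp]: "space mu = UNIV"
  using sets_eq_imp_space_eq[OF sets_mu] by simp

sublocale pp: product_prob_space "\<lambda>_. mu" UNIV
  by unfold_locales

text \<open>Taking the image forgets order and multiplicity, so a sampled set can have fewer than
  \<open>n\<close> points when coordinates coincide; \<open>AE_inj\<close> later excludes this for
  measures without atoms.\<close>

definition sample :: "nat \<Rightarrow> 'a set measure" where
  "sample n = distr (PiM {..<n} (\<lambda>_. mu)) conf (\<lambda>x. x ` {..<n})"

lemmas measurable_image = measurable_image_conf[OF _ sets_mu]

lemma emeasure_image_void:
  assumes "finite J" "A \<in> sets borel"
  shows "emeasure (distr (PiM J (\<lambda>_. mu)) conf (\<lambda>x. x ` J)) (void A) = emeasure mu (- A) ^ card J"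
proof -
  have "(\<lambda>x. x ` J) -` void A \<inter> space (PiM J (\<lambda>_. mu)) = (\<Pi>\<^sub>E i\<in>J. - A)"
    using assms(1) by (auto simp: void_def space_PiM PiE_iff)
  then show ?thesis
    using assms sets_mu by (simp add: emeasure_distr measurable_image pp.emeasure_PiM)
qed

lemma prob_space_PiM_mu: "prob_space (PiM J (\<lambda>_. mu))"
  by (rule prob_space_PiM) unfold_locales

lemma prob_space_sample: "prob_space (sample n)"
  unfolding sample_def
  by (intro prob_space.prob_space_distr prob_space_PiM_mu measurable_image) simp

lemma sets_sample [simp, measurable_cong]: "sets (sample n) = sets conf"
  by (simp add: sample_def)

lemma space_sample [simp]: "space (sample n) = Collect finite"
  using sets_eq_imp_space_eq[OF sets_sample] by simp

text \<open>Exchangeability: the void probabilities of the image are powers of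
  \<open>emeasure mu (- A)\<close> and see the index set only through its cardinality.\<close>

lemma distr_image_eq_sample:
  assumes "finite J"
  shows "distr (PiM J (\<lambda>_. mu)) conf (\<lambda>x. x ` J) = sample (card J)"
  unfolding sample_def
  using assms
  by (intro conf_measure_eqI prob_space.prob_space_distr prob_space_PiM_mu measurable_image)
     (auto simp: emeasure_image_void)

lemma emeasure_sample_void:
  assumes "A \<in> sets borel"
  shows "emeasure (sample n) (void A) = emeasure mu (- A) ^ n"
  using emeasure_image_void[of "{..<n}" A] assms by (simp add: sample_def)

lemma measure_sample_void:
  assumes "A \<in> sets borel"
  shows "measure (sample n) (void A) = measure mu (- A) ^ n"
proof -
  interpret S: prob_space "sample n" by (rule prob_space_sample)
  show ?thesis
    using emeasure_sample_void[OF assms, of n]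
    by (simp add: emeasure_eq_measure S.emeasure_eq_measure ennreal_power)
qed

lemma measurable_image_subset:
  assumes "finite I" "S \<subseteq> I"
  shows "(\<lambda>x. x ` S) \<in> PiM I (\<lambda>_. mu) \<rightarrow>\<^sub>M conf"
proof -
  have "(\<lambda>x. restrict x S ` S) \<in> PiM I (\<lambda>_. mu) \<rightarrow>\<^sub>M conf"
    using measurable_compose[OF measurable_restrict_subset[OF assms(2)] measurable_image]
      finite_subset[OF assms(2,1)] by blast
  then show ?thesis by (simp cong: image_cong_simp)
qed

lemma measurable_split:
  assumes "finite I" "S \<subseteq> I"
  shows "(\<lambda>x. (x ` S, x ` (I - S))) \<in> PiM I (\<lambda>_. mu) \<rightarrow>\<^sub>M conf \<Otimes>\<^sub>M conf"
  using assms by (intro measurable_Pair measurable_image_subset) auto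

text \<open>Coordinates over disjoint index sets are independent, by the decomposition of the
  product measure with \<open>merge\<close>, and each block depends only on its size. Both the
  factorial moment and the inclusion-exclusion terms are computed by this splitting.\<close>

lemma distr_split_sample:
  assumes "finite I" "S \<subseteq> I"
  shows "distr (PiM I (\<lambda>_. mu)) (conf \<Otimes>\<^sub>M conf) (\<lambda>x. (x ` S, x ` (I - S)))
    = sample (card S) \<Otimes>\<^sub>M sample (card (I - S))"
proof -
  let ?P = "\<lambda>J. PiM J (\<lambda>_. mu)"
  have fin: "finite S" "finite (I - S)" "S \<union> (I - S) = I" using assms finite_subset by auto
  have "?P I = distr (?P S \<Otimes>\<^sub>M ?P (I - S)) (?P I) (merge S (I - S))"
    using pp.distr_merge[of S "I - S"] fin by simp
  then have "distr (?P I) (conf \<Otimes>\<^sub>M conf) (\<lambda>x. (x ` S, x ` (I - S)))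
     = distr (distr (?P S \<Otimes>\<^sub>M ?P (I - S)) (?P I) (merge S (I - S))) (conf \<Otimes>\<^sub>M conf) (\<lambda>x. (x ` S, x ` (I - S)))"
    by simp
  also have "\<dots> = distr (?P S \<Otimes>\<^sub>M ?P (I - S)) (conf \<Otimes>\<^sub>M conf)
      ((\<lambda>x. (x ` S, x ` (I - S))) \<circ> merge S (I - S))"
  proof (rule distr_distr)
    show "(\<lambda>x. (x ` S, x ` (I - S))) \<in> ?P I \<rightarrow>\<^sub>M conf \<Otimes>\<^sub>M conf"
      by (rule measurable_split[OF assms])
    show "merge S (I - S) \<in> ?P S \<Otimes>\<^sub>M ?P (I - S) \<rightarrow>\<^sub>M ?P I"
      using measurable_merge[of S "I - S" "\<lambda>_. mu"] fin by simp
  qed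
  also have "(\<lambda>x. (x ` S, x ` (I - S))) \<circ> merge S (I - S) = (\<lambda>(x, y). (x ` S, y ` (I - S)))"
  proof
    fix p
    have "merge S (I - S) p ` S = fst p ` S" "merge S (I - S) p ` (I - S) = snd p ` (I - S)"
      by (auto simp: merge_def split_beta intro!: image_cong)
    then show "((\<lambda>x. (x ` S, x ` (I - S))) \<circ> merge S (I - S)) p = (\<lambda>(x, y). (x ` S, y ` (I - S))) p"
      by (auto simp: split_beta)
  qed
  also have "distr (?P S \<Otimes>\<^sub>M ?P (I - S)) (conf \<Otimes>\<^sub>M conf) (\<lambda>(x, y). (x ` S, y ` (I - S)))
     = distr (?P S) conf (\<lambda>x. x ` S) \<Otimes>\<^sub>M distr (?P (I - S)) conf (\<lambda>x. x ` (I - S))"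
    using fin by (intro pair_measure_distr[symmetric] measurable_image prob_space_imp_sigma_finite
        prob_space.prob_space_distr prob_space_PiM_mu) auto
  finally show ?thesis using fin by (simp add: distr_image_eq_sample)
qed

section \<open>Almost sure absence of coincidences\<close>

lemma emeasure_finite_eq_0:
  assumes "finite \<xi>" "\<And>x. emeasure mu {x} = 0"
  shows "emeasure mu \<xi> = 0"
proof -
  have "emeasure mu \<xi> = (\<Sum>x\<in>\<xi>. emeasure mu {x})"
    using assms(1) by (intro emeasure_eq_sum_singleton) (auto simp: sets_mu)
  then show ?thesis using assms(2) by simp
qed

lemma AE_disjoint_finite:
  assumes "finite I" "finite \<xi>" "\<And>x. emeasure mu {x} = 0"
  shows "AE x in PiM I (\<lambda>_. mu). x ` I \<inter> \<xi> = {}"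
proof -
  have "emeasure mu \<xi> = 0" using assms(2,3) by (rule emeasure_finite_eq_0)
  then have "AE y in mu. y \<notin> \<xi>"
    using assms(2) by (intro AE_I'[of \<xi>]) (auto simp: null_sets_def sets_mu finite_imp_closed)
  then have "AE x in PiM I (\<lambda>_. mu). \<forall>i\<in>I. x i \<notin> \<xi>"
    using assms(1) by (intro AE_finite_allI AE_PiM_component) (auto intro: prob_space_axioms)
  then show ?thesis by eventually_elim auto
qed

text \<open>A coincidence at index \<open>i\<close> means that the single point \<open>x i\<close>
  belongs to the set of the other points. These are independent of it and form a finite set, which
  is null when \<open>mu\<close> has no atoms.\<close>

lemma AE_inj:
  assumes "finite I" "\<And>x. emeasure mu {x} = 0"
  shows "AE x in PiM I (\<lambda>_. mu). inj_on x I"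
proof -
  have "AE x in PiM I (\<lambda>_. mu). \<not> x ` {i} \<subseteq> x ` (I - {i})" if "i \<in> I" for i
  proof -
    interpret P: pair_prob_space "sample (card {i})" "sample (card (I - {i}))"
      by (intro pair_prob_space.intro pair_sigma_finite.intro prob_space_imp_sigma_finite prob_space_sample)
    have "AE \<beta> in sample m. AE \<alpha> in sample (card {i}). \<not> \<alpha> \<subseteq> \<beta>" for m
    proof (rule AE_I2)
      fix \<beta> assume "\<beta> \<in> space (sample m)"
      then have fin: "finite \<beta>" by simp
      have 0: "emeasure mu \<beta> = 0" using fin assms(2) by (rule emeasure_finite_eq_0)
      have b: "- \<beta> \<in> sets borel" using fin by (simp add: finite_imp_closed)
      \<comment> \<open>\<open>void (- \<beta>)\<close> consists of the finite subsets of
        \<open>\<beta>\<close>, so for a sample of one point its probability is the mass of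
        \<open>\<beta>\<close>.\<close>
      have "void (- \<beta>) \<in> null_sets (sample (card {i}))"
        using emeasure_sample_void[OF b, of 1] 0 b by (auto simp: null_sets_def)
      then show "AE \<alpha> in sample (card {i}). \<not> \<alpha> \<subseteq> \<beta>"
        by (rule AE_I') (auto simp: void_def)
    qed
    then have "AE p in sample (card {i}) \<Otimes>\<^sub>M sample (card (I - {i})). \<not> fst p \<subseteq> snd p"
    proof (intro P.AE_pair_measure)
      show *: "{p \<in> space (sample (card {i}) \<Otimes>\<^sub>M sample (card (I - {i}))). \<not> fst p \<subseteq> snd p}
        \<in> sets (sample (card {i}) \<Otimes>\<^sub>M sample (card (I - {i})))"
        by measurable
      assume ae: "AE \<beta> in sample m. AE \<alpha> in sample (card {i}). \<not> \<alpha> \<subseteq> \<beta>" for m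
      \<comment> \<open>The null statement is available with \<open>\<beta>\<close> fixed first; the
        order of the two factors has to be exchanged.\<close>
      show "AE \<alpha> in sample (card {i}). AE \<beta> in sample (card (I - {i})). \<not> fst (\<alpha>, \<beta>) \<subseteq> snd (\<alpha>, \<beta>)"
        using P.AE_commute[OF *] ae by simp
    qed
    then have "AE p in distr (PiM I (\<lambda>_. mu)) (conf \<Otimes>\<^sub>M conf) (\<lambda>x. (x ` {i}, x ` (I - {i}))). \<not> fst p \<subseteq> snd p"
      using that by (subst distr_split_sample[OF assms(1)]) auto
    then show ?thesis
      using measurable_split[of I "{i}"] assms that by (subst (asm) AE_distr_iff) auto
  qed
  then have "AE x in PiM I (\<lambda>_. mu). \<forall>i\<in>I. \<not> x ` {i} \<subseteq> x ` (I - {i})"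
    using assms(1) by (intro AE_finite_allI) auto
  then show ?thesis
    by eventually_elim (auto simp: inj_on_def)
qed

section \<open>The law of the Poisson process\<close>

lemma sample_in_subprob_algebra [measurable]:
  "sample \<in> measure_pmf p \<rightarrow>\<^sub>M subprob_algebra conf"
proof -
  have "sample n \<in> space (subprob_algebra conf)" for n
    by (simp add: space_subprob_algebra prob_space_imp_subprob_space prob_space_sample)
  then show ?thesis by simp
qed

text \<open>As \<open>mu\<close> has total mass 1, the number of points is Poisson with parameter
  \<open>t\<close>. This mixture turns expectations into series over the sample size.\<close>

definition poisson_law :: "real \<Rightarrow> 'a set measure" where
  "poisson_law t = measure_pmf (poisson_pmf t) \<bind> sample"

lemma sets_poisson_law [simp, measurable_cong]: "sets (poisson_law t) = sets conf"
  unfolding poisson_law_def by (rule sets_bind) auto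

lemma space_poisson_law [simp]: "space (poisson_law t) = Collect finite"
  using sets_eq_imp_space_eq[OF sets_poisson_law] by simp

lemma prob_space_poisson_law: "prob_space (poisson_law t)"
  unfolding poisson_law_def
  by (rule prob_space.prob_space_bind[where S = conf])
     (auto simp: prob_space_measure_pmf prob_space_sample sample_in_subprob_algebra simp del: measurable_pmf_measure1)

lemma nn_integral_poisson_law:
  assumes [measurable]: "f \<in> borel_measurable conf"
  shows "(\<integral>\<^sup>+\<xi>. f \<xi> \<partial>poisson_law t) = (\<Sum>n. ennreal (pmf (poisson_pmf t) n) * (\<integral>\<^sup>+\<xi>. f \<xi> \<partial>sample n))"
proof -
  have "(\<integral>\<^sup>+\<xi>. f \<xi> \<partial>poisson_law t) = (\<integral>\<^sup>+n. (\<integral>\<^sup>+\<xi>. f \<xi> \<partial>sample n) \<partial>measure_pmf (poisson_pmf t))"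
    unfolding poisson_law_def by (rule nn_integral_bind) measurable
  then show ?thesis
    by (simp add: nn_integral_measure_pmf nn_integral_count_space_nat)
qed

text \<open>Summing the Poisson weights against the powers of \<open>measure mu (- A)\<close> is an
  exponential series with value \<open>exp (- t) * exp (t * measure mu (- A))\<close>.\<close>

lemma emeasure_poisson_law_void:
  assumes "0 < t" "A \<in> sets borel"
  shows "emeasure (poisson_law t) (void A) = ennreal (exp (- (t * measure mu A)))"
proof -
  have [measurable]: "A \<in> sets borel" by fact
  have q: "measure mu (- A) = 1 - measure mu A"
    using prob_compl[of A] assms by (simp add: sets_mu Compl_eq_Diff_UNIV)
  have "(\<lambda>n. exp (- t) * ((t * measure mu (- A)) ^ n /\<^sub>R fact n)) sums (exp (- t) * exp (t * measure mu (- A)))"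
    by (intro sums_mult exp_converges)
  also have "exp (- t) * exp (t * measure mu (- A)) = exp (- (t * measure mu A))"
    by (simp add: q exp_add[symmetric] algebra_simps)
  also have "(\<lambda>n. exp (- t) * ((t * measure mu (- A)) ^ n /\<^sub>R fact n))
      = (\<lambda>n. pmf (poisson_pmf t) n * measure mu (- A) ^ n)"
    using assms(1) by (simp add: pmf_poisson power_mult_distrib field_simps)
  finally have s: "(\<lambda>n. pmf (poisson_pmf t) n * measure mu (- A) ^ n) sums exp (- (t * measure mu A))" .
  have "emeasure (poisson_law t) (void A) = (\<integral>\<^sup>+\<xi>. indicator (void A) \<xi> \<partial>poisson_law t)"
    by simp
  also have "\<dots> = (\<Sum>n. ennreal (pmf (poisson_pmf t) n) * emeasure (sample n) (void A))"
    using assms(2) by (subst nn_integral_poisson_law) (simp_all only: nn_integral_indicator sets_void sets_sample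
      borel_measurable_indicator)
  also have "\<dots> = (\<Sum>n. ennreal (pmf (poisson_pmf t) n * measure mu (- A) ^ n))"
    using assms(2) by (simp only: emeasure_sample_void emeasure_eq_measure ennreal_power ennreal_mult
        measure_nonneg pmf_nonneg zero_le_power)
  also have "\<dots> = ennreal (exp (- (t * measure mu A)))"
    using s by (intro suminf_ennreal_eq) auto
  finally show ?thesis .
qed

lemma poisson_point_process_measurable:
  assumes "poisson_point_process M mu t eta"
  shows "eta \<in> M \<rightarrow>\<^sub>M conf"
proof (rule measurable_confI)
  show "finite (eta w)" if "w \<in> space M" for w
    using assms that by (auto simp: poisson_point_process_def)
  fix A :: "'a set" assume "A \<in> sets borel"
  then have [measurable]: "(\<lambda>w. card (eta w \<inter> A)) \<in> M \<rightarrow>\<^sub>M count_space UNIV"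
    using assms by (auto simp: poisson_point_process_def poisson_distributed_def sets_mu)
  have "{w \<in> space M. eta w \<inter> A = {}} = {w \<in> space M. card (eta w \<inter> A) = 0}"
    using assms by (auto simp: poisson_point_process_def)
  also have "\<dots> \<in> sets M" by measurable
  finally show "{w \<in> space M. eta w \<inter> A = {}} \<in> sets M" .
qed

text \<open>A void event says that a Poisson count is zero, which has the probability just computed
  for the mixture; equality of void probabilities identifies the laws.\<close>

lemma distr_poisson_point_process:
  assumes "prob_space M" "0 < t" "poisson_point_process M mu t eta"
  shows "distr M conf eta = poisson_law t"
proof (rule conf_measure_eqI)
  note [measurable] = poisson_point_process_measurable[OF assms(3)]
  interpret M: prob_space M by fact
  show "prob_space (distr M conf eta)" by (rule M.prob_space_distr) measurable
  fix A :: "'a set" assume A [measurable]: "A \<in> sets borel"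
  have "eta -` void A \<inter> space M = {w \<in> space M. card (eta w \<inter> A) = 0}"
    using assms(3) by (auto simp: poisson_point_process_def void_def)
  moreover have "measure M {w \<in> space M. card (eta w \<inter> A) = 0} = exp (- (t * measure mu A))"
    using assms(3) A by (auto simp: poisson_point_process_def poisson_distributed_def sets_mu)
  ultimately show "emeasure (distr M conf eta) (void A) = emeasure (poisson_law t) (void A)"
    using assms(2) A by (simp add: emeasure_distr emeasure_poisson_law_void M.emeasure_eq_measure)
qed (simp_all add: prob_space_poisson_law)

section \<open>Factorial moments of the number of vertices\<close>

text \<open>For distinct points, vertices correspond to indices, so the binomial coefficient counts
  index sets of size \<open>k\<close> all of whose points are vertices. Writing the points as two
  blocks prepares for \<open>distr_split_sample\<close>.\<close>

lemma choose_verts_eq_sum: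
  assumes "finite I" "inj_on x I"
  shows "card (verts (x ` I)) choose k =
    (\<Sum>S | S \<subseteq> I \<and> card S = k. if x ` S \<subseteq> verts (x ` S \<union> x ` (I - S)) then 1 else 0)"
proof -
  define W where "W = {i \<in> I. x i \<in> verts (x ` I)}"
  have "x ` W = verts (x ` I)" using verts_subset[of "x ` I"] by (auto simp: W_def)
  moreover have "inj_on x W" using assms(2) by (rule inj_on_subset) (auto simp: W_def)
  ultimately have "card (verts (x ` I)) = card W" by (metis card_image)
  then have "card (verts (x ` I)) choose k = card {S. S \<subseteq> W \<and> card S = k}"
    using assms(1) by (simp add: n_subsets W_def)
  also have "{S. S \<subseteq> W \<and> card S = k} = {S \<in> {S. S \<subseteq> I \<and> card S = k}. x ` S \<subseteq> verts (x ` S \<union> x ` (I - S))}"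
  proof -
    have "S \<subseteq> W \<longleftrightarrow> S \<subseteq> I \<and> x ` S \<subseteq> verts (x ` S \<union> x ` (I - S))" for S
    proof (cases "S \<subseteq> I")
      case True
      then have "x ` S \<union> x ` (I - S) = x ` I" by blast
      then show ?thesis using True by (auto simp: W_def)
    qed (auto simp: W_def)
    then show ?thesis by auto
  qed
  also have "card \<dots> = (\<Sum>S | S \<subseteq> I \<and> card S = k. if x ` S \<subseteq> verts (x ` S \<union> x ` (I - S)) then 1 else 0)"
    using assms(1) by (simp add: sum.If_cases Int_def)
  finally show ?thesis .
qed

text \<open>The chance that \<open>k\<close> fresh independent points added to
  \<open>\<beta>\<close> all become vertices. The finiteness conjunct keeps the event inside the
  space of \<open>sample k\<close>.\<close>

definition ext_prob :: "nat \<Rightarrow> 'a set \<Rightarrow> ennreal" where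
  "ext_prob k \<beta> = emeasure (sample k) {\<alpha>. finite \<alpha> \<and> \<alpha> \<subseteq> verts (\<alpha> \<union> \<beta>)}"

text \<open>Each index set of size \<open>k\<close> contributes the same amount: split off its
  points and integrate them out first. For \<open>n < k\<close> the truncated difference
  \<open>n - k\<close> is harmless because the binomial coefficient is 0.\<close>

lemma nn_integral_sample_choose:
  assumes "\<And>x. emeasure mu {x} = 0"
  shows "(\<integral>\<^sup>+\<xi>. of_nat (card (verts \<xi>) choose k) \<partial>sample n)
    = of_nat (n choose k) * (\<integral>\<^sup>+\<beta>. ext_prob k \<beta> \<partial>sample (n - k))"
proof -
  let ?I = "{..<n}" and ?P = "PiM {..<n} (\<lambda>_. mu)"
  let ?A = "{p \<in> space (conf \<Otimes>\<^sub>M conf). fst p \<subseteq> verts (fst p \<union> snd p)} :: ('a set \<times> 'a set) set"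
  have [measurable]: "?A \<in> sets (conf \<Otimes>\<^sub>M conf)" by measurable
  have one: "(\<integral>\<^sup>+x. indicator ?A (x ` S, x ` (?I - S)) \<partial>?P) = (\<integral>\<^sup>+\<beta>. ext_prob k \<beta> \<partial>sample (n - k))"
    if S: "S \<subseteq> ?I" "card S = k" for S
  proof -
    interpret Q: pair_sigma_finite "sample k" "sample (n - k)"
      by (intro pair_sigma_finite.intro prob_space_imp_sigma_finite prob_space_sample)
    have c: "card (?I - S) = n - k" using S by (simp add: card_Diff_subset finite_subset)
    have "(\<integral>\<^sup>+x. indicator ?A (x ` S, x ` (?I - S)) \<partial>?P)
      = (\<integral>\<^sup>+p. indicator ?A p \<partial>distr ?P (conf \<Otimes>\<^sub>M conf) (\<lambda>x. (x ` S, x ` (?I - S))))"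
      using S by (intro nn_integral_distr[symmetric] measurable_split) auto
    also have "\<dots> = (\<integral>\<^sup>+p. indicator ?A p \<partial>(sample k \<Otimes>\<^sub>M sample (n - k)))"
      using S c by (simp add: distr_split_sample)
    also have "\<dots> = (\<integral>\<^sup>+\<beta>. \<integral>\<^sup>+\<alpha>. indicator ?A (\<alpha>, \<beta>) \<partial>sample k \<partial>sample (n - k))"
      by (rule Q.nn_integral_snd[symmetric]) measurable
    also have "\<dots> = (\<integral>\<^sup>+\<beta>. ext_prob k \<beta> \<partial>sample (n - k))"
    proof (rule nn_integral_cong)
      fix \<beta> :: "'a set" assume b: "\<beta> \<in> space (sample (n - k))"
      let ?B = "{\<alpha>. finite \<alpha> \<and> \<alpha> \<subseteq> verts (\<alpha> \<union> \<beta>)}"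
      have "(\<lambda>_. \<beta>) \<in> conf \<rightarrow>\<^sub>M conf" using b by simp
      then have "{\<alpha> \<in> space conf. \<alpha> \<subseteq> verts (\<alpha> \<union> \<beta>)} \<in> sets conf"
        by measurable
      then have "?B \<in> sets (sample k)" by simp
      moreover have "(\<integral>\<^sup>+\<alpha>. indicator ?A (\<alpha>, \<beta>) \<partial>sample k) = (\<integral>\<^sup>+\<alpha>. indicator ?B \<alpha> \<partial>sample k)"
        using b by (intro nn_integral_cong) (auto simp: space_pair_measure split: split_indicator)
      ultimately show "(\<integral>\<^sup>+\<alpha>. indicator ?A (\<alpha>, \<beta>) \<partial>sample k) = ext_prob k \<beta>"
        by (simp add: ext_prob_def)
    qed
    finally show ?thesis .
  qed
  have "(\<integral>\<^sup>+\<xi>. of_nat (card (verts \<xi>) choose k) \<partial>sample n)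
     = (\<integral>\<^sup>+x. of_nat (card (verts (x ` ?I)) choose k) \<partial>?P)"
    unfolding sample_def by (rule nn_integral_distr) (auto intro: measurable_image)
  also have "\<dots> = (\<integral>\<^sup>+x. (\<Sum>S | S \<subseteq> ?I \<and> card S = k. indicator ?A (x ` S, x ` (?I - S))) \<partial>?P)"
  proof (rule nn_integral_cong_AE)
    show "AE x in ?P. of_nat (card (verts (x ` ?I)) choose k) =
        (\<Sum>S | S \<subseteq> ?I \<and> card S = k. indicator ?A (x ` S, x ` (?I - S)) :: ennreal)"
      using AE_inj[OF finite_lessThan assms]
    proof eventually_elim
      case (elim x)
      have "of_nat (card (verts (x ` ?I)) choose k) = (\<Sum>S | S \<subseteq> ?I \<and> card S = k.
          of_nat (if x ` S \<subseteq> verts (x ` S \<union> x ` (?I - S)) then 1 else 0) :: ennreal)"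
        by (simp only: choose_verts_eq_sum[OF finite_lessThan elim] of_nat_sum)
      also have "\<dots> = (\<Sum>S | S \<subseteq> ?I \<and> card S = k. indicator ?A (x ` S, x ` (?I - S)))"
        by (rule sum.cong) (auto simp: space_pair_measure indicator_def intro: finite_subset)
      finally show ?case .
    qed
  qed
  also have "\<dots> = (\<Sum>S | S \<subseteq> ?I \<and> card S = k. \<integral>\<^sup>+x. indicator ?A (x ` S, x ` (?I - S)) \<partial>?P)"
    by (rule nn_integral_sum) (auto intro!: measurable_compose[OF measurable_split])
  also have "\<dots> = (\<Sum>S | S \<subseteq> ?I \<and> card S = k. \<integral>\<^sup>+\<beta>. ext_prob k \<beta> \<partial>sample (n - k))"
    by (rule sum.cong) (auto simp: one)
  also have "\<dots> = of_nat (n choose k) * (\<integral>\<^sup>+\<beta>. ext_prob k \<beta> \<partial>sample (n - k))"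
    by (simp add: n_subsets)
  finally show ?thesis .
qed

lemma measurable_ext_prob [measurable]: "ext_prob k \<in> borel_measurable conf"
proof -
  interpret S: prob_space "sample k" by (rule prob_space_sample)
  have "(\<lambda>\<beta>. emeasure (sample k) (Pair \<beta> -` {p \<in> space (conf \<Otimes>\<^sub>M sample k). snd p \<subseteq> verts (snd p \<union> fst p)}))
     \<in> borel_measurable conf"
    by (rule S.measurable_emeasure_Pair) measurable
  moreover have "Pair \<beta> -` {p \<in> space (conf \<Otimes>\<^sub>M sample k). snd p \<subseteq> verts (snd p \<union> fst p)}
     = {\<alpha>. finite \<alpha> \<and> \<alpha> \<subseteq> verts (\<alpha> \<union> \<beta>)}" if "\<beta> \<in> space conf" for \<beta>
    using that by (auto simp: space_pair_measure)
  ultimately show ?thesis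
    unfolding ext_prob_def
    by (subst measurable_cong[where g = "\<lambda>\<beta>. emeasure (sample k)
      (Pair \<beta> -` {p \<in> space (conf \<Otimes>\<^sub>M sample k). snd p \<subseteq> verts (snd p \<union> fst p)})"]) simp_all
qed

text \<open>An instance of the multivariate Mecke formula, with ordered tuples of distinct vertices
  counted by \<open>fact k\<close> times a binomial coefficient. It reduces to the identity that
  turns the Poisson weight at \<open>m + k\<close> into \<open>t ^ k\<close> times the weight at
  \<open>m\<close>.\<close>

lemma nn_integral_choose_poisson_law:
  assumes "\<And>x. emeasure mu {x} = 0" "0 < t"
  shows "(\<integral>\<^sup>+\<xi>. of_nat (fact k * (card (verts \<xi>) choose k)) \<partial>poisson_law t)
    = ennreal (t ^ k) * (\<integral>\<^sup>+\<beta>. ext_prob k \<beta> \<partial>poisson_law t)"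
proof -
  define a where "a m = (\<integral>\<^sup>+\<beta>. ext_prob k \<beta> \<partial>sample m)" for m
  define g where "g n = ennreal (pmf (poisson_pmf t) n) * (of_nat (fact k) * (of_nat (n choose k) * a (n - k)))" for n
  have "(\<integral>\<^sup>+\<xi>. of_nat (fact k * (card (verts \<xi>) choose k)) \<partial>poisson_law t) = (\<Sum>n. g n)"
  proof -
    have 1: "(\<integral>\<^sup>+\<xi>. of_nat (fact k * (card (verts \<xi>) choose k)) \<partial>poisson_law t)
      = (\<Sum>n. ennreal (pmf (poisson_pmf t) n) * (\<integral>\<^sup>+\<xi>. of_nat (fact k * (card (verts \<xi>) choose k)) \<partial>sample n))"
      by (rule nn_integral_poisson_law) measurable
    have 2: "(\<integral>\<^sup>+\<xi>. of_nat (fact k * (card (verts \<xi>) choose k)) \<partial>sample n)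
      = of_nat (fact k) * (of_nat (n choose k) * a (n - k))" for n
    proof -
      have "(\<integral>\<^sup>+\<xi>. of_nat (fact k * (card (verts \<xi>) choose k)) \<partial>sample n)
        = of_nat (fact k) * (\<integral>\<^sup>+\<xi>. of_nat (card (verts \<xi>) choose k) \<partial>sample n)"
        unfolding of_nat_mult by (rule nn_integral_cmult) measurable
      then show ?thesis by (simp only: nn_integral_sample_choose[OF assms(1)] a_def)
    qed
    show ?thesis by (simp only: 1 2 g_def)
  qed
  \<comment> \<open>The terms below \<open>k\<close> vanish since \<open>n choose k\<close> is 0
    there.\<close>
  also have "\<dots> = (\<Sum>m. g (m + k))"
  proof -
    have "(\<Sum>n. g n) = (\<Sum>m. g (m + k)) + (\<Sum>m<k. g m)"
      by (rule suminf_offset) auto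
    moreover have "(\<Sum>m<k. g m) = 0" by (rule sum.neutral) (simp add: g_def)
    ultimately show ?thesis by simp
  qed
  also have "\<dots> = (\<Sum>m. ennreal (t ^ k) * (ennreal (pmf (poisson_pmf t) m) * a m))"
  proof (rule suminf_cong)
    fix m
    have "pmf (poisson_pmf t) (m + k) * (fact k * real ((m + k) choose k)) = t ^ k * pmf (poisson_pmf t) m"
      using assms(2) by (simp add: pmf_poisson binomial_fact power_add field_simps)
    then have "ennreal (pmf (poisson_pmf t) (m + k)) * (ennreal (fact k) * ennreal (real ((m + k) choose k)))
       = ennreal (t ^ k) * ennreal (pmf (poisson_pmf t) m)"
      using assms(2) by (simp add: ennreal_mult[symmetric])
    moreover have "ennreal (fact k) = of_nat (fact k)" "ennreal (real ((m + k) choose k)) = of_nat ((m + k) choose k)"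
      by (metis ennreal_of_nat_eq_real_of_nat of_nat_fact) (simp add: ennreal_of_nat_eq_real_of_nat)
    ultimately show "g (m + k) = ennreal (t ^ k) * (ennreal (pmf (poisson_pmf t) m) * a m)"
      unfolding g_def by (simp add: mult.assoc[symmetric])
  qed
  also have "\<dots> = ennreal (t ^ k) * (\<integral>\<^sup>+\<beta>. ext_prob k \<beta> \<partial>poisson_law t)"
    by (simp add: nn_integral_poisson_law a_def)
  finally show ?thesis .
qed

end

section \<open>Inclusion-exclusion for vertices\<close>

lemma sum_Pow_card:
  fixes f :: "nat \<Rightarrow> real"
  assumes "finite I"
  shows "(\<Sum>S\<in>Pow I. f (card S)) = (\<Sum>r\<le>card I. real (card I choose r) * f r)"
proof -
  have "(\<Sum>S\<in>Pow I. f (card S)) = (\<Sum>r\<le>card I. \<Sum>S\<in>{S \<in> Pow I. card S = r}. f (card S))"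
    using assms by (intro sum.group[symmetric]) (auto intro: card_mono)
  also have "\<dots> = (\<Sum>r\<le>card I. real (card I choose r) * f r)"
  proof (rule sum.cong[OF refl])
    fix r
    have "(\<Sum>S\<in>{S \<in> Pow I. card S = r}. f (card S)) = (\<Sum>S | S \<subseteq> I \<and> card S = r. f r)"
      by (rule sum.cong) auto
    then show "(\<Sum>S\<in>{S \<in> Pow I. card S = r}. f (card S)) = real (card I choose r) * f r"
      using assms by (simp add: n_subsets)
  qed
  finally show ?thesis .
qed

lemma alternating_sum_Pow:
  assumes "finite W"
  shows "(\<Sum>S\<in>Pow W. (- 1) ^ card S) = (if W = {} then 1 else 0 :: real)"
proof (cases "W = {}")
  case False
  then have "0 < card W" using assms by (simp add: card_gt_0_iff)
  then have "(\<Sum>r\<le>card W. (- 1) ^ r * real (card W choose r)) = 0"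
    by (rule choose_alternating_sum)
  then show ?thesis using False sum_Pow_card[OF assms, of "\<lambda>r. (- 1) ^ r"] by (simp add: mult.commute)
qed simp

text \<open>Points inside the hull of \<open>\<zeta>\<close> change neither hull nor vertices;
  conversely the vertices span the hull. This form reduces measurability of hull inclusion to that
  of \<open>verts\<close> and of set inclusion.\<close>

lemma subset_hull_iff_verts:
  assumes "finite \<alpha>" "finite \<zeta>"
  shows "\<alpha> \<subseteq> convex hull \<zeta> \<longleftrightarrow> verts (\<alpha> \<union> \<zeta>) \<subseteq> \<zeta>"
proof
  assume "\<alpha> \<subseteq> convex hull \<zeta>"
  then have "\<alpha> \<union> \<zeta> \<subseteq> convex hull \<zeta>" using hull_subset[of \<zeta> convex] by simp
  then have "convex hull (\<alpha> \<union> \<zeta>) = convex hull \<zeta>"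
    by (intro equalityI hull_mono hull_minimal) auto
  then have "verts (\<alpha> \<union> \<zeta>) = verts \<zeta>" by (simp add: verts_def)
  then show "verts (\<alpha> \<union> \<zeta>) \<subseteq> \<zeta>" using verts_subset by simp
next
  assume "verts (\<alpha> \<union> \<zeta>) \<subseteq> \<zeta>"
  then have "convex hull (\<alpha> \<union> \<zeta>) \<subseteq> convex hull \<zeta>"
    using hull_verts[of "\<alpha> \<union> \<zeta>"] hull_mono[of "verts (\<alpha> \<union> \<zeta>)" \<zeta> convex] assms by simp
  moreover have "\<alpha> \<subseteq> convex hull (\<alpha> \<union> \<zeta>)" using hull_subset[of "\<alpha> \<union> \<zeta>" convex] by simp
  ultimately show "\<alpha> \<subseteq> convex hull \<zeta>" by (rule order_trans[rotated])
qed

lemma pred_subset_hull [measurable (raw)]: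
  fixes f g :: "'b \<Rightarrow> 'a::euclidean_space set"
  assumes [measurable]: "f \<in> N \<rightarrow>\<^sub>M conf" "g \<in> N \<rightarrow>\<^sub>M conf"
  shows "Measurable.pred N (\<lambda>x. f x \<subseteq> convex hull (g x))"
proof -
  have "Measurable.pred N (\<lambda>x. verts (f x \<union> g x) \<subseteq> g x)" by measurable
  then show ?thesis
    by (rule measurable_cong[THEN iffD1, rotated])
       (use measurable_space[OF assms(1)] measurable_space[OF assms(2)] in \<open>simp only: subset_hull_iff_verts space_conf mem_Collect_eq\<close>)
qed

lemma borel_hull [measurable]:
  fixes \<xi> :: "'a::euclidean_space set"
  shows "finite \<xi> \<Longrightarrow> convex hull \<xi> \<in> sets borel"
  by (rule borel_closed, rule compact_imp_closed, rule finite_imp_compact_convex_hull)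

text \<open>If some \<open>x i\<close> lies in the hull of \<open>\<xi>\<close>, both sides are 0.
  Otherwise the condition for \<open>S\<close> says that \<open>S\<close> consists of indices of
  non-vertices, and the alternating sum over subsets of that index set is 1 exactly when it is
  empty.\<close>

lemma verts_incl_excl:
  fixes x :: "'i \<Rightarrow> 'a::euclidean_space"
  assumes "finite I" "finite \<xi>" "inj_on x I" "x ` I \<inter> \<xi> = {}"
  shows "(if x ` I \<subseteq> verts (x ` I \<union> \<xi>) then 1 else 0 :: real) =
    (\<Sum>S\<in>Pow I. (- 1) ^ card S *
      (if x ` I \<inter> convex hull \<xi> = {} \<and> x ` S \<subseteq> convex hull (\<xi> \<union> x ` (I - S)) then 1 else 0))"
proof (cases "x ` I \<inter> convex hull \<xi> = {}")
  case False
  then obtain i where i: "i \<in> I" "x i \<in> convex hull \<xi>" by auto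
  define \<eta> where "\<eta> = x ` I \<union> \<xi>"
  have fin: "finite \<eta>" using assms by (simp add: \<eta>_def)
  \<comment> \<open>Since \<open>x i\<close> is not in \<open>\<xi>\<close>, deleting it keeps all
    of \<open>\<xi>\<close>, whose hull contains it; hence it is no vertex.\<close>
  have sub: "\<xi> \<subseteq> \<eta> - {x i}" using assms i by (auto simp: \<eta>_def)
  have "x i \<in> convex hull (\<eta> - {x i})" using i(2) hull_mono[OF sub] by blast
  moreover have "\<eta> - {x i} \<subseteq> convex hull (\<eta> - {x i})" by (rule hull_subset)
  ultimately have "\<eta> \<subseteq> convex hull (\<eta> - {x i})" by blast
  then have "x i \<notin> verts \<eta>" using verts_disjoint_iff[OF fin, of "{x i}"] by simp
  then have "\<not> x ` I \<subseteq> verts (x ` I \<union> \<xi>)" using i by (auto simp: \<eta>_def)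
  with False show ?thesis by simp
next
  case True
  define \<eta> where "\<eta> = x ` I \<union> \<xi>"
  have fin: "finite \<eta>" using assms by (simp add: \<eta>_def)
  define W where "W = {i \<in> I. x i \<notin> verts \<eta>}"
  have iff: "x ` S \<subseteq> convex hull (\<xi> \<union> x ` (I - S)) \<longleftrightarrow> S \<subseteq> W" if S: "S \<subseteq> I" for S
  proof -
    \<comment> \<open>Without coincidences, deleting the points of \<open>S\<close> deletes neither
      a point of \<open>\<xi>\<close> nor one with another index.\<close>
    have diff: "\<eta> - x ` S = \<xi> \<union> x ` (I - S)"
      using assms(4) S inj_on_image_set_diff[OF assms(3), of I S] by (auto simp: \<eta>_def)
    have un: "\<eta> = x ` S \<union> (\<eta> - x ` S)" using S by (auto simp: \<eta>_def)
    have "S \<subseteq> W \<longleftrightarrow> verts \<eta> \<inter> x ` S = {}" using S by (auto simp: W_def)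
    also have "\<dots> \<longleftrightarrow> \<eta> \<subseteq> convex hull (\<eta> - x ` S)" by (rule verts_disjoint_iff[OF fin])
    also have "\<dots> \<longleftrightarrow> x ` S \<subseteq> convex hull (\<eta> - x ` S)"
      using un hull_subset[of "\<eta> - x ` S" convex] by (metis Un_subset_iff)
    finally show ?thesis by (simp add: diff)
  qed
  have "(\<Sum>S\<in>Pow I. (- 1) ^ card S *
      (if x ` I \<inter> convex hull \<xi> = {} \<and> x ` S \<subseteq> convex hull (\<xi> \<union> x ` (I - S)) then 1 else 0))
    = (\<Sum>S\<in>Pow I. if S \<in> Pow W then (- 1) ^ card S else 0 :: real)"
    using True by (intro sum.cong) (auto simp: iff)
  also have "\<dots> = (\<Sum>S\<in>Pow I \<inter> Pow W. (- 1) ^ card S)"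
    using assms(1) by (simp add: sum.inter_restrict)
  also have "Pow I \<inter> Pow W = Pow W" by (auto simp: W_def)
  also have "(\<Sum>S\<in>Pow W. (- 1) ^ card S) = (if W = {} then 1 else 0 :: real)"
    using assms(1) by (intro alternating_sum_Pow) (simp add: W_def)
  also have "W = {} \<longleftrightarrow> x ` I \<subseteq> verts (x ` I \<union> \<xi>)" by (auto simp: W_def \<eta>_def)
  finally show ?thesis by simp
qed

lemma void_Int_finite [simp]: "void A \<inter> Collect finite = void A"
  by (auto simp: void_def)

lemma falling_fact_eq: "falling_fact n k = real (fact k * (n choose k))"
proof -
  have "real (n choose k) = (\<Prod>i = 0..<k. real n - real i) / fact k"
    by (simp add: binomial_gbinomial gbinomial_prod_rev)
  then show ?thesis by (simp add: falling_fact_def atLeast0LessThan)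
qed

section \<open>Integrating the inclusion-exclusion terms\<close>

context borel_prob
begin

text \<open>The integrand of the term of order \<open>r\<close>, as a function of the set of added
  points; the first factor encodes integration over the complement of the hull.\<close>

definition gap :: "nat \<Rightarrow> 'a set \<Rightarrow> 'a set \<Rightarrow> real" where
  "gap r \<xi> \<beta> = (if \<beta> \<inter> convex hull \<xi> = {} then 1 else 0) *
     measure mu (convex hull (\<xi> \<union> \<beta>) - convex hull \<xi>) ^ r"

text \<open>The region is the section at \<open>p\<close> of a set that is jointly measurable in
  \<open>p\<close> and the tested point, so measurability of section measures applies.\<close>

lemma measurable_measure_hull_diff [measurable (raw)]:
  assumes [measurable]: "f \<in> N \<rightarrow>\<^sub>M conf" "g \<in> N \<rightarrow>\<^sub>M conf"
  shows "(\<lambda>p. measure mu (convex hull (f p \<union> g p) - convex hull (f p))) \<in> borel_measurable N"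
proof -
  let ?Q = "{q \<in> space (N \<Otimes>\<^sub>M mu). snd q \<in> convex hull (f (fst q) \<union> g (fst q)) \<and>
    snd q \<notin> convex hull (f (fst q))}"
  have [measurable]: "(\<lambda>p. emeasure mu (Pair p -` ?Q)) \<in> borel_measurable N"
    by (rule measurable_emeasure_Pair) measurable
  have "(\<lambda>p. measure mu (Pair p -` ?Q)) \<in> borel_measurable N"
    unfolding measure_def by measurable
  moreover have "Pair p -` ?Q = convex hull (f p \<union> g p) - convex hull (f p)"
    if "p \<in> space N" for p
    using that by (auto simp: space_pair_measure)
  ultimately show ?thesis
    by (subst measurable_cong[where g = "\<lambda>p. measure mu (Pair p -` ?Q)"]) simp_all
qed

lemma measurable_gap:
  assumes "finite \<xi>"
  shows "gap r \<xi> \<in> borel_measurable conf"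
proof -
  have "(\<lambda>\<beta>. measure mu (convex hull (\<xi> \<union> \<beta>) - convex hull \<xi>)) \<in> borel_measurable conf"
    using assms by (intro measurable_measure_hull_diff) simp_all
  moreover have "Measurable.pred conf (\<lambda>\<beta>. \<beta> \<inter> convex hull \<xi> = {})"
    using borel_hull[OF assms] by (intro void_pred) simp_all
  ultimately show ?thesis
    unfolding gap_def[abs_def]
    by (intro borel_measurable_times borel_measurable_power measurable_If) (simp_all add: pred_def)
qed

lemma gap_bounds: "0 \<le> gap r \<xi> \<beta>" "gap r \<xi> \<beta> \<le> 1"
  by (simp_all add: gap_def power_le_one)

text \<open>Given the points \<open>\<beta>\<close> with indices outside \<open>S\<close>, the
  points with indices in \<open>S\<close> must all fall into the region that \<open>\<beta>\<close>
  adds to the hull. They are independent of \<open>\<beta>\<close> and of each other, which yields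
  the power \<open>card S\<close>.\<close>

lemma integral_split_gap:
  assumes "finite \<xi>" "finite I" "S \<subseteq> I"
  shows "(\<integral>x. (if x ` I \<inter> convex hull \<xi> = {} \<and> x ` S \<subseteq> convex hull (\<xi> \<union> x ` (I - S)) then 1 else 0) \<partial>PiM I (\<lambda>_. mu))
    = (\<integral>\<beta>. gap (card S) \<xi> \<beta> \<partial>sample (card I - card S))"
proof -
  let ?P = "PiM I (\<lambda>_. mu)" and ?r = "card S" and ?m = "card I - card S"
  define F :: "'a set \<Rightarrow> 'a set \<Rightarrow> real" where "F \<alpha> \<beta> = (if \<beta> \<inter> convex hull \<xi> = {} then 1 else 0) *
    (if \<alpha> \<inter> convex hull \<xi> = {} \<and> \<alpha> \<subseteq> convex hull (\<xi> \<union> \<beta>) then 1 else 0)" for \<alpha> \<beta>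
  have [measurable]: "convex hull \<xi> \<in> sets borel" using assms(1) by (rule borel_hull)
  have [measurable]: "(\<lambda>_. \<xi>) \<in> N \<rightarrow>\<^sub>M conf" for N :: "('a set \<times> 'a set) measure" using assms(1) by simp
  have F [measurable]: "case_prod F \<in> borel_measurable (conf \<Otimes>\<^sub>M conf)"
    unfolding F_def split_beta by measurable
  interpret Q: pair_prob_space "sample ?r" "sample ?m"
    by (intro pair_prob_space.intro pair_sigma_finite.intro prob_space_imp_sigma_finite prob_space_sample)
  have c: "card (I - S) = ?m" using assms by (simp add: card_Diff_subset finite_subset)
  have "(\<integral>x. (if x ` I \<inter> convex hull \<xi> = {} \<and> x ` S \<subseteq> convex hull (\<xi> \<union> x ` (I - S)) then 1 else 0) \<partial>?P)
    = (\<integral>x. case_prod F (x ` S, x ` (I - S)) \<partial>?P)"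
  proof (rule Bochner_Integration.integral_cong[OF refl])
    fix x :: "'b \<Rightarrow> 'a"
    have "x ` I = x ` S \<union> x ` (I - S)" using assms(3) by blast
    then have "x ` I \<inter> convex hull \<xi> = {} \<longleftrightarrow> x ` S \<inter> convex hull \<xi> = {} \<and> x ` (I - S) \<inter> convex hull \<xi> = {}"
      by (simp add: Int_Un_distrib2)
    then show "(if x ` I \<inter> convex hull \<xi> = {} \<and> x ` S \<subseteq> convex hull (\<xi> \<union> x ` (I - S)) then 1 else 0)
      = case_prod F (x ` S, x ` (I - S))" by (simp add: F_def)
  qed
  also have "\<dots> = (\<integral>p. case_prod F p \<partial>distr ?P (conf \<Otimes>\<^sub>M conf) (\<lambda>x. (x ` S, x ` (I - S))))"
    using assms by (intro integral_distr[symmetric] measurable_split F)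
  also have "\<dots> = (\<integral>p. case_prod F p \<partial>(sample ?r \<Otimes>\<^sub>M sample ?m))"
    using assms c by (simp add: distr_split_sample)
  also have "\<dots> = (\<integral>\<beta>. (\<integral>\<alpha>. F \<alpha> \<beta> \<partial>sample ?r) \<partial>sample ?m)"
  proof (rule Q.integral_snd[symmetric])
    show "integrable (sample ?r \<Otimes>\<^sub>M sample ?m) (case_prod F)"
      by (rule Q.integrable_const_bound[where B = 1]) (auto simp: F_def)
  qed
  also have "\<dots> = (\<integral>\<beta>. gap ?r \<xi> \<beta> \<partial>sample ?m)"
  proof (rule Bochner_Integration.integral_cong[OF refl])
    fix \<beta> :: "'a set" assume "\<beta> \<in> space (sample ?m)"
    then have fin: "finite (\<xi> \<union> \<beta>)" using assms(1) by simp
    define D where "D = convex hull (\<xi> \<union> \<beta>) - convex hull \<xi>"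
    have D: "D \<in> sets borel" using borel_hull[OF fin] by (simp add: D_def)
    \<comment> \<open>Both conditions on \<open>\<alpha>\<close> together say that it is contained
      in \<open>D\<close>, that is, void on the complement.\<close>
    have "(\<integral>\<alpha>. F \<alpha> \<beta> \<partial>sample ?r) = (\<integral>\<alpha>. (if \<beta> \<inter> convex hull \<xi> = {} then 1 else 0) * indicator (void (- D)) \<alpha> \<partial>sample ?r)"
      by (rule Bochner_Integration.integral_cong[OF refl]) (auto simp: F_def D_def void_def indicator_def)
    also have "\<dots> = (if \<beta> \<inter> convex hull \<xi> = {} then 1 else 0) * measure (sample ?r) (void (- D))"
      using D by simp
    also have "measure (sample ?r) (void (- D)) = measure mu D ^ ?r"
      using measure_sample_void[of "- D" ?r] D by (simp add: borel_comp)
    finally show "(\<integral>\<alpha>. F \<alpha> \<beta> \<partial>sample ?r) = gap ?r \<xi> \<beta>"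
      by (simp add: gap_def D_def)
  qed
  finally show ?thesis .
qed

text \<open>\<open>verts_incl_excl\<close> holds almost surely and is integrated termwise; each
  integral depends on \<open>S\<close> only through its cardinality, so subsets are grouped by
  size.\<close>

lemma ext_prob_eq:
  assumes "\<And>x. emeasure mu {x} = 0" "finite \<xi>"
  shows "enn2real (ext_prob k \<xi>) =
    (\<Sum>r\<le>k. real (k choose r) * ((- 1) ^ r * (\<integral>\<beta>. gap r \<xi> \<beta> \<partial>sample (k - r))))"
proof -
  let ?I = "{..<k}" and ?P = "PiM {..<k} (\<lambda>_. mu)"
  let ?f = "\<lambda>S x. if x ` ?I \<inter> convex hull \<xi> = {} \<and> x ` S \<subseteq> convex hull (\<xi> \<union> x ` (?I - S)) then 1 else 0 :: real"
  interpret P: prob_space ?P by (rule prob_space_PiM_mu)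
  have [measurable]: "convex hull \<xi> \<in> sets borel" using assms(2) by (rule borel_hull)
  have [measurable]: "(\<lambda>_. \<xi>) \<in> N \<rightarrow>\<^sub>M conf" for N :: "'c measure" using assms(2) by simp
  have set: "{\<alpha> \<in> space conf. \<alpha> \<subseteq> verts (\<alpha> \<union> \<xi>)} \<in> sets conf" by measurable
  have f: "?f S \<in> borel_measurable ?P" if "S \<subseteq> ?I" for S
  proof -
    have [measurable]: "(\<lambda>x. x ` S) \<in> ?P \<rightarrow>\<^sub>M conf" "(\<lambda>x. x ` (?I - S)) \<in> ?P \<rightarrow>\<^sub>M conf" "(\<lambda>x. x ` ?I) \<in> ?P \<rightarrow>\<^sub>M conf"
      using that by (auto intro!: measurable_image_subset)
    show ?thesis by measurable
  qed
  have "enn2real (ext_prob k \<xi>) = measure (sample k) {\<alpha> \<in> space conf. \<alpha> \<subseteq> verts (\<alpha> \<union> \<xi>)}"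
    by (simp add: ext_prob_def measure_def)
  also have "\<dots> = (\<integral>\<alpha>. indicator {\<alpha> \<in> space conf. \<alpha> \<subseteq> verts (\<alpha> \<union> \<xi>)} \<alpha> \<partial>sample k)"
    using set by (simp add: Int_absorb2 Collect_mono)
  also have "\<dots> = (\<integral>x. indicator {\<alpha> \<in> space conf. \<alpha> \<subseteq> verts (\<alpha> \<union> \<xi>)} (x ` ?I) \<partial>?P)"
    unfolding sample_def using set by (intro integral_distr measurable_image) auto
  also have "\<dots> = (\<integral>x. (\<Sum>S\<in>Pow ?I. (- 1) ^ card S * ?f S x) \<partial>?P)"
  proof (rule integral_cong_AE)
    show "(\<lambda>x. indicator {\<alpha> \<in> space conf. \<alpha> \<subseteq> verts (\<alpha> \<union> \<xi>)} (x ` ?I)) \<in> borel_measurable ?P"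
      using set by (intro measurable_compose[OF measurable_image]) auto
    show "(\<lambda>x. \<Sum>S\<in>Pow ?I. (- 1) ^ card S * ?f S x) \<in> borel_measurable ?P"
      by (intro borel_measurable_sum borel_measurable_times f) auto
    show "AE x in ?P. indicator {\<alpha> \<in> space conf. \<alpha> \<subseteq> verts (\<alpha> \<union> \<xi>)} (x ` ?I)
       = (\<Sum>S\<in>Pow ?I. (- 1) ^ card S * ?f S x)"
      using AE_inj[OF finite_lessThan assms(1)] AE_disjoint_finite[OF finite_lessThan assms(2,1)]
    proof eventually_elim
      case (elim x)
      show ?case
        by (subst verts_incl_excl[OF finite_lessThan assms(2) elim, symmetric]) (simp add: indicator_def)
    qed
  qed
  also have "\<dots> = (\<Sum>S\<in>Pow ?I. \<integral>x. (- 1) ^ card S * ?f S x \<partial>?P)"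
    by (rule Bochner_Integration.integral_sum, rule P.integrable_const_bound[where B = 1])
       (auto intro!: borel_measurable_times f simp: abs_mult power_abs)
  also have "\<dots> = (\<Sum>S\<in>Pow ?I. (- 1) ^ card S * (\<integral>\<beta>. gap (card S) \<xi> \<beta> \<partial>sample (k - card S)))"
  proof (rule sum.cong[OF refl])
    fix S assume "S \<in> Pow ?I"
    then have S: "S \<subseteq> ?I" by simp
    show "(\<integral>x. (- 1) ^ card S * ?f S x \<partial>?P) = (- 1) ^ card S * (\<integral>\<beta>. gap (card S) \<xi> \<beta> \<partial>sample (k - card S))"
      using integral_split_gap[OF assms(2) finite_lessThan S] by simp
  qed
  also have "\<dots> = (\<Sum>r\<le>k. real (k choose r) * ((- 1) ^ r * (\<integral>\<beta>. gap r \<xi> \<beta> \<partial>sample (k - r))))"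
    using sum_Pow_card[of ?I "\<lambda>r. (- 1) ^ r * (\<integral>\<beta>. gap r \<xi> \<beta> \<partial>sample (k - r))"] by simp
  finally show ?thesis .
qed

lemma integral_gap_sample:
  assumes "finite \<xi>"
  shows "(\<integral>\<beta>. gap r \<xi> \<beta> \<partial>sample m) =
    (\<integral>x. (\<Prod>i<m. indicator (UNIV - convex hull \<xi>) (x i))
        * measure mu (convex hull (\<xi> \<union> x ` {..<m}) - convex hull \<xi>) ^ r \<partial>PiM {..<m} (\<lambda>_. mu))"
proof -
  have "(\<integral>\<beta>. gap r \<xi> \<beta> \<partial>sample m) = (\<integral>x. gap r \<xi> (x ` {..<m}) \<partial>PiM {..<m} (\<lambda>_. mu))"
    unfolding sample_def using assms by (intro integral_distr measurable_image measurable_gap) auto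
  also have "\<dots> = (\<integral>x. (\<Prod>i<m. indicator (UNIV - convex hull \<xi>) (x i))
        * measure mu (convex hull (\<xi> \<union> x ` {..<m}) - convex hull \<xi>) ^ r \<partial>PiM {..<m} (\<lambda>_. mu))"
  proof (rule Bochner_Integration.integral_cong[OF refl])
    fix x :: "nat \<Rightarrow> 'a"
    have "(\<Prod>i<m. indicator (UNIV - convex hull \<xi>) (x i) :: real) = (if x ` {..<m} \<inter> convex hull \<xi> = {} then 1 else 0)"
    proof (cases "x ` {..<m} \<inter> convex hull \<xi> = {}")
      case True
      then show ?thesis by (auto intro!: prod.neutral simp: indicator_def)
    next
      case False
      then show ?thesis by (auto intro!: prod_zero simp: indicator_def)
    qed
    then show "gap r \<xi> (x ` {..<m}) = (\<Prod>i<m. indicator (UNIV - convex hull \<xi>) (x i))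
        * measure mu (convex hull (\<xi> \<union> x ` {..<m}) - convex hull \<xi>) ^ r"
      by (simp add: gap_def)
  qed
  finally show ?thesis .
qed

text \<open>The power 0 is 1, even on a null region, so only the avoidance event remains. This
  supplies the moment of the missed mass.\<close>

lemma integral_gap_0:
  assumes "finite \<xi>"
  shows "(\<integral>\<beta>. gap 0 \<xi> \<beta> \<partial>sample m) = measure mu (UNIV - convex hull \<xi>) ^ m"
proof -
  have "(\<integral>\<beta>. gap 0 \<xi> \<beta> \<partial>sample m) = (\<integral>\<beta>. indicator (void (convex hull \<xi>)) \<beta> \<partial>sample m)"
    by (rule Bochner_Integration.integral_cong[OF refl]) (auto simp: gap_def void_def)
  also have "\<dots> = measure (sample m) (void (convex hull \<xi>))"
    using borel_hull[OF assms] by simp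
  finally show ?thesis
    using measure_sample_void[OF borel_hull[OF assms]] by (simp add: Compl_eq_Diff_UNIV)
qed

text \<open>With no added points the region is empty, and \<open>0 ^ r\<close> is 0 for positive
  \<open>r\<close>: the term with \<open>r = k\<close> drops out.\<close>

lemma integral_gap_top:
  assumes "finite \<xi>" "0 < r"
  shows "(\<integral>\<beta>. gap r \<xi> \<beta> \<partial>sample 0) = 0"
  unfolding integral_gap_sample[OF assms(1)] using assms(2) by (simp add: zero_power)

lemma measurable_integral_gap: "(\<lambda>\<xi>. \<integral>\<beta>. gap r \<xi> \<beta> \<partial>sample m) \<in> borel_measurable conf"
proof -
  let ?P = "PiM {..<m} (\<lambda>_. mu)"
  interpret P: prob_space ?P by (rule prob_space_PiM_mu)
  have [measurable]: "(\<lambda>p. snd p ` {..<m}) \<in> conf \<Otimes>\<^sub>M ?P \<rightarrow>\<^sub>M conf"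
    by (rule measurable_compose[OF measurable_snd measurable_image]) simp
  \<comment> \<open>The indicator set varies with \<open>\<xi>\<close>; the conditional form exposes
    hull membership as a jointly measurable predicate.\<close>
  have ind: "indicator (UNIV - H) y = (if y \<in> H then 0 else 1 :: real)" for H and y :: 'a
    by (simp add: indicator_def)
  have "(\<lambda>\<xi>. \<integral>x. (\<Prod>i<m. indicator (UNIV - convex hull \<xi>) (x i))
        * measure mu (convex hull (\<xi> \<union> x ` {..<m}) - convex hull \<xi>) ^ r \<partial>?P) \<in> borel_measurable conf"
    unfolding ind by (rule P.borel_measurable_lebesgue_integral) (unfold split_beta, measurable)
  then show ?thesis
    by (rule measurable_cong[THEN iffD1, rotated]) (simp add: integral_gap_sample)
qed

text \<open>The moment is computed as a nonnegative integral and converted back. The converted value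
  is finite, being \<open>t ^ k\<close> times the integral of a probability, so
  \<open>enn2real\<close> loses nothing.\<close>

lemma integral_falling_fact:
  assumes "\<And>x. emeasure mu {x} = 0" "0 < t"
  shows "(\<integral>\<xi>. falling_fact (card (verts \<xi>)) k \<partial>poisson_law t)
    = t ^ k * (\<Sum>r\<le>k. real (k choose r) * ((- 1) ^ r * (\<integral>\<xi>. (\<integral>\<beta>. gap r \<xi> \<beta> \<partial>sample (k - r)) \<partial>poisson_law t)))"
proof -
  interpret P: prob_space "poisson_law t" by (rule prob_space_poisson_law)
  have "(\<integral>\<xi>. falling_fact (card (verts \<xi>)) k \<partial>poisson_law t)
    = enn2real (\<integral>\<^sup>+\<xi>. ennreal (falling_fact (card (verts \<xi>)) k) \<partial>poisson_law t)"
    by (rule integral_eq_nn_integral) (simp_all add: falling_fact_eq)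
  also have "\<dots> = enn2real (\<integral>\<^sup>+\<xi>. of_nat (fact k * (card (verts \<xi>) choose k)) \<partial>poisson_law t)"
    unfolding falling_fact_eq ennreal_of_nat_eq_real_of_nat ..
  also have "\<dots> = t ^ k * enn2real (\<integral>\<^sup>+\<beta>. ext_prob k \<beta> \<partial>poisson_law t)"
    unfolding nn_integral_choose_poisson_law[OF assms] using assms(2) by (simp add: enn2real_mult)
  also have "enn2real (\<integral>\<^sup>+\<beta>. ext_prob k \<beta> \<partial>poisson_law t) = (\<integral>\<beta>. enn2real (ext_prob k \<beta>) \<partial>poisson_law t)"
  proof -
    interpret S: prob_space "sample k" by (rule prob_space_sample)
    have "ext_prob k \<beta> = ennreal (enn2real (ext_prob k \<beta>))" for \<beta>
      unfolding ext_prob_def by (simp add: S.emeasure_eq_measure)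
    then have "(\<integral>\<^sup>+\<beta>. ext_prob k \<beta> \<partial>poisson_law t) = (\<integral>\<^sup>+\<beta>. ennreal (enn2real (ext_prob k \<beta>)) \<partial>poisson_law t)"
      by simp
    then show ?thesis by (simp add: integral_eq_nn_integral)
  qed
  also have "\<dots> = (\<integral>\<xi>. (\<Sum>r\<le>k. real (k choose r) * ((- 1) ^ r * (\<integral>\<beta>. gap r \<xi> \<beta> \<partial>sample (k - r)))) \<partial>poisson_law t)"
    by (rule Bochner_Integration.integral_cong[OF refl]) (simp add: ext_prob_eq[OF assms(1)])
  also have "\<dots> = (\<Sum>r\<le>k. real (k choose r) * ((- 1) ^ r * (\<integral>\<xi>. (\<integral>\<beta>. gap r \<xi> \<beta> \<partial>sample (k - r)) \<partial>poisson_law t)))"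
  proof -
    \<comment> \<open>Each inner integral lies between 0 and 1, which lets the finite sum pass
      through the expectation.\<close>
    have "integrable (poisson_law t) (\<lambda>\<xi>. \<integral>\<beta>. gap r \<xi> \<beta> \<partial>sample m)" for r m
    proof (rule P.integrable_const_bound[where B = 1])
      interpret S: prob_space "sample m" by (rule prob_space_sample)
      show "(\<lambda>\<xi>. \<integral>\<beta>. gap r \<xi> \<beta> \<partial>sample m) \<in> borel_measurable (poisson_law t)"
        using measurable_integral_gap by (simp cong: measurable_cong_sets)
      show "AE \<xi> in poisson_law t. norm (\<integral>\<beta>. gap r \<xi> \<beta> \<partial>sample m) \<le> 1"
      proof (rule AE_I2)
        fix \<xi> :: "'a set" assume "\<xi> \<in> space (poisson_law t)"
        then have "gap r \<xi> \<in> borel_measurable conf"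
          by (intro measurable_gap) simp
        then have "integrable (sample m) (gap r \<xi>)"
          by (intro S.integrable_const_bound[where B = 1]) (auto simp: gap_bounds)
        then have "(\<integral>\<beta>. gap r \<xi> \<beta> \<partial>sample m) \<le> 1"
          by (intro S.integral_le_const) (auto simp: gap_bounds)
        moreover have "0 \<le> (\<integral>\<beta>. gap r \<xi> \<beta> \<partial>sample m)"
          by (rule Bochner_Integration.integral_nonneg) (simp add: gap_bounds)
        ultimately show "norm (\<integral>\<beta>. gap r \<xi> \<beta> \<partial>sample m) \<le> 1" by simp
      qed
    qed
    then show ?thesis by simp
  qed
  finally show ?thesis .
qed

end

theorem theorem5:
  fixes M :: "'w measure" and mu :: "'a::euclidean_space measure"
    and t :: real and eta :: "'w \<Rightarrow> 'a set" and k :: nat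
  assumes "prob_space M"
    and "prob_space mu" and "sets mu = sets borel"
    and "absolutely_continuous lborel mu"
    and "t > 0"
    and "poisson_point_process M mu t eta"
  shows "(\<integral>w. falling_fact (num_vertices (convex hull (eta w))) k \<partial>M)
       = t ^ k * (\<integral>w. (measure mu (UNIV - convex hull (eta w))) ^ k \<partial>M)
         - t ^ k * (\<Sum>r = 1..k - 1. (-1) ^ (r + 1) * real (k choose r) *
             (\<integral>w. (\<integral>x. (\<Prod>i<k - r. indicator (UNIV - convex hull (eta w)) (x i))
                 * (measure mu (convex hull (eta w \<union> x ` {..<k - r}) - convex hull (eta w))) ^ r
               \<partial>(PiM {..<k - r} (\<lambda>_. mu))) \<partial>M))"
proof -
  interpret M: prob_space M by fact
  interpret borel_prob mu
    using assms(2,3) by (simp add: borel_prob_def borel_prob_axioms_def)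
  have atomless: "emeasure mu {x} = 0" for x
  proof -
    have "{x} \<in> null_sets lborel" by (simp add: null_sets_def)
    then show ?thesis using assms(4) by (auto simp: absolutely_continuous_def)
  qed
  note eta [measurable] = poisson_point_process_measurable[OF assms(6)]
  have fin: "finite (eta w)" if "w \<in> space M" for w
    using measurable_space[OF eta that] by simp
  define E where "E r = (\<integral>w. (\<integral>\<beta>. gap r (eta w) \<beta> \<partial>sample (k - r)) \<partial>M)" for r
  \<comment> \<open>Expectations over \<open>M\<close> depend on \<open>eta\<close> only through its
    law, so they are transferred to \<open>poisson_law t\<close> and back.\<close>
  have E: "(\<integral>\<xi>. (\<integral>\<beta>. gap r \<xi> \<beta> \<partial>sample (k - r)) \<partial>poisson_law t) = E r" for r
    unfolding E_def distr_poisson_point_process[OF assms(1,5,6), symmetric]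
    by (rule integral_distr[OF eta measurable_integral_gap])
  have "(\<lambda>\<xi> :: 'a set. falling_fact (card (verts \<xi>)) k) \<in> borel_measurable conf"
    unfolding falling_fact_eq by measurable
  then have "(\<integral>w. falling_fact (num_vertices (convex hull (eta w))) k \<partial>M)
      = (\<integral>\<xi>. falling_fact (card (verts \<xi>)) k \<partial>poisson_law t)"
    unfolding distr_poisson_point_process[OF assms(1,5,6), symmetric] num_vertices_def verts_def[symmetric]
    by (rule integral_distr[OF eta, symmetric])
  also have "\<dots> = t ^ k * (\<Sum>r\<le>k. real (k choose r) * ((- 1) ^ r * E r))"
    unfolding integral_falling_fact[OF atomless assms(5)] E ..
  also have "(\<Sum>r\<le>k. real (k choose r) * ((- 1) ^ r * E r))
      = E 0 - (\<Sum>r = 1..k - 1. (- 1) ^ (r + 1) * real (k choose r) * E r)"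
  \<comment> \<open>For \<open>k = 0\<close> the indices \<open>0\<close> and \<open>k\<close>
    coincide and the range \<open>1..k - 1\<close> is empty; for positive \<open>k\<close> the last
    term vanishes. The exponent \<open>r + 1\<close> absorbs the minus sign in front of the
    sum.\<close>
  proof (cases k)
    case 0
    then show ?thesis by simp
  next
    case (Suc m)
    have top: "E k = 0"
      unfolding E_def using Suc
      by (subst Bochner_Integration.integral_cong[OF refl, where g = "\<lambda>_. 0"]) (simp_all add: integral_gap_top fin)
    have "{..k} = insert 0 (insert k {1..k - 1})" using Suc by auto
    then have "(\<Sum>r\<le>k. real (k choose r) * ((- 1) ^ r * E r))
        = E 0 + (\<Sum>r = 1..k - 1. real (k choose r) * ((- 1) ^ r * E r))"
      using Suc top by simp
    then show ?thesis by (simp add: sum_negf[symmetric] mult_ac)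
  qed
  also have "E 0 = (\<integral>w. (measure mu (UNIV - convex hull (eta w))) ^ k \<partial>M)"
    unfolding E_def by (rule Bochner_Integration.integral_cong[OF refl]) (simp add: integral_gap_0 fin)
  also have "(\<Sum>r = 1..k - 1. (- 1) ^ (r + 1) * real (k choose r) * E r)
      = (\<Sum>r = 1..k - 1. (-1) ^ (r + 1) * real (k choose r) *
             (\<integral>w. (\<integral>x. (\<Prod>i<k - r. indicator (UNIV - convex hull (eta w)) (x i))
                 * (measure mu (convex hull (eta w \<union> x ` {..<k - r}) - convex hull (eta w))) ^ r
               \<partial>(PiM {..<k - r} (\<lambda>_. mu))) \<partial>M))"
  proof (rule sum.cong[OF refl])
    fix r
    have "E r = (\<integral>w. (\<integral>x. (\<Prod>i<k - r. indicator (UNIV - convex hull (eta w)) (x i))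
                 * (measure mu (convex hull (eta w \<union> x ` {..<k - r}) - convex hull (eta w))) ^ r
               \<partial>(PiM {..<k - r} (\<lambda>_. mu))) \<partial>M)"
      unfolding E_def by (rule Bochner_Integration.integral_cong[OF refl]) (rule integral_gap_sample[OF fin])
    then show "(- 1) ^ (r + 1) * real (k choose r) * E r = (-1) ^ (r + 1) * real (k choose r) *
             (\<integral>w. (\<integral>x. (\<Prod>i<k - r. indicator (UNIV - convex hull (eta w)) (x i))
                 * (measure mu (convex hull (eta w \<union> x ` {..<k - r}) - convex hull (eta w))) ^ r
               \<partial>(PiM {..<k - r} (\<lambda>_. mu))) \<partial>M)"
      by (simp only:)
  qed
  finally show ?thesis by (simp only: right_diff_distrib)
qed

end
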